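(* Let $T$ be a Hausdorff topological monoid with unit $1_T$ which contains the extended bicyclic semigroup $\mathscr{C}_{\mathbb{Z}}$ as a dense subsemigroup. Put $$L_{\mathscr{C}_{\mathbb{Z}}}=\{x\in T\setminus\mathscr{C}_{\mathbb{Z}}\mid \text{there exists } y\in\mathscr{C}_{\mathbb{Z}} \text{ such that } x\cdot y\in\mathscr{C}_{\mathbb{Z}}\},$$ $$R_{\mathscr{C}_{\mathbb{Z}}}=\{x\in T\setminus\mathscr{C}_{\mathbb{Z}}\mid \text{there exists } y\in\mathscr{C}_{\mathbb{Z}} \text{ such that } y\cdot x\in\mathscr{C}_{\mathbb{Z}}\},$$ ${\uparrow}\mathscr{C}_{\mathbb{Z}}=\mathscr{C}_{\mathbb{Z}}\cup L_{\mathscr{C}_{\mathbb{Z}}}$ and $I=T\setminus{\uparrow}\mathscr{C}_{\mathbb{Z}}$. Then the following assertions hold: (i) if $L_{\mathscr{C}_{\mathbb{Z}}}$ is non-empty, then $L_{\mathscr{C}_{\mathbb{Z}}}$ is a subsemigroup of $T$, and moreover if $a\in L_{\mathscr{C}_{\mathbb{Z}}}$, then there exists an open neighbourhood $U(a)$ of $a$ in $T$ such that $n_1-m_1=n_2-m_2$ for all $(n_1,m_1),(n_2,m_2)\in U(a)\cap\mathscr{C}_{\mathbb{Z}}$; (ii) if $R_{\mathscr{C}_{\mathbb{Z}}}$ is non-empty, then $R_{\mathscr{C}_{\mathbb{Z}}}$ is a subsemigroup of $T$, and moreover if $a\in R_{\mathscr{C}_{\mathbb{Z}}}$, then there exists an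 open neighbourhood $U(a)$ of $a$ in $T$ such that $n_1-m_1=n_2-m_2$ for all $(n_1,m_1),(n_2,m_2)\in U(a)\cap\mathscr{C}_{\mathbb{Z}}$; (iii) if $L_{\mathscr{C}_{\mathbb{Z}}}$ (resp. $R_{\mathscr{C}_{\mathbb{Z}}}$) is non-empty, then for every $a\in L_{\mathscr{C}_{\mathbb{Z}}}$ (resp. $a\in R_{\mathscr{C}_{\mathbb{Z}}}$) there exist an open neighbourhood $U(a)$ of $a$ in $T$ and an integer $n_a$ such that $p\leqslant n_a$ and $q\leqslant n_a$ for all $(p,q)\in U(a)\cap\mathscr{C}_{\mathbb{Z}}$; (iv) $L_{\mathscr{C}_{\mathbb{Z}}}=R_{\mathscr{C}_{\mathbb{Z}}}$; (v) ${\uparrow}\mathscr{C}_{\mathbb{Z}}$ is a subsemigroup of $T$ and $\mathscr{C}_{\mathbb{Z}}$ is a minimal ideal in ${\uparrow}\mathscr{C}_{\mathbb{Z}}$; (vi) if for an element $a\in T\setminus\mathscr{C}_{\mathbb{Z}}$ there is an open neighbourhood $U(a)$ of $a$ in $T$ such that (a) $m_1-m_2=n_1-n_2$ for all $(m_1,n_1),(m_2,n_2)\in U(a)\cap\mathscr{C}_{\mathbb{Z}}$, and (b) there exists an integer $n_a$ such that $n\leqslant n_a$ and $m\leqslant n_a$ for every $(m,n)\in U(a)\cap\mathscr{C}_{\mathbb{Z}}$, then $a\in L_{\mathscr{C}_{\mathbb{Z}}}$; (vii) if $I\neq\varnothing$, then $I$ is an ideal of $T$; (viii) for every $(a,b)\in\mathscr{C}_{\mathbb{Z}}$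 the sets $\{x\in T\mid x\cdot(b,b)=(a,b)\}$, $\{x\in T\mid (a,a)\cdot x=(a,b)\}$ and $\{x\in T\mid (a,a)\cdot x\cdot(b,b)=(a,b)\}$ coincide, and this common set, denoted ${\uparrow}(a,b)$, is closed-and-open in $T$; (ix) for every $(a,b)\in\mathscr{C}_{\mathbb{Z}}$ the set ${\uparrow}(a,b)\cap L_{\mathscr{C}_{\mathbb{Z}}}$ is either a singleton or empty; (x) $L_{\mathscr{C}_{\mathbb{Z}}}$ is isomorphic to a submonoid of the additive group of integers $\mathbb{Z}$, and moreover if a maximal subgroup of $L_{\mathscr{C}_{\mathbb{Z}}}$ is non-singleton, then $L_{\mathscr{C}_{\mathbb{Z}}}$ is isomorphic to the additive group of integers $\mathbb{Z}$; (xi) ${\uparrow}\mathscr{C}_{\mathbb{Z}}$ is an open subset in $T$, and hence if $I\neq\varnothing$, then the ideal $I$ is a closed subset in $T$; (xii) if $T$ contains a non-singleton group of units $H(1_T)$, then $H(1_T)=T\setminus(\mathscr{C}_{\mathbb{Z}}\cup I)$.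
   Context: The extended bicyclic semigroup $\mathscr{C}_{\mathbb{Z}}$ is the set $\mathbb{Z}\times\mathbb{Z}$ with the operation $(a,b)\cdot(c,d)=(a-b+c,d)$ if $b<c$; $(a,b)\cdot(c,d)=(a,d)$ if $b=c$; $(a,b)\cdot(c,d)=(a,d+b-c)$ if $b>c$. A topological semigroup is a Hausdorff topological space with a jointly continuous semigroup operation; a topological monoid is a topological semigroup with a unit. "Ideal" means two-sided ideal. $H(1_T)$ denotes the group of units of $T$. *)

theory Defs
  imports "HOL-Analysis.Elementary_Topology" "HOL-Algebra.Elementary_Groups"
begin

text \<open>The operation of the extended bicyclic semigroup on the set of pairs of integers.\<close>

fun ebic_mult :: "int \<times> int \<Rightarrow> int \<times> int \<Rightarrow> int \<times> int" where
  "ebic_mult (a, b) (c, d) =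
     (if b < c then (a - b + c, d) else if b = c then (a, d) else (a, d + b - c))"

lemma ebic_mult_assoc: "ebic_mult (ebic_mult x y) z = ebic_mult x (ebic_mult y z)"
  by (cases x; cases y; cases z) auto

text \<open>
  A copy of the extended bicyclic semigroup inside a semigroup is given by an injective
  homomorphism \<open>\<iota>\<close>; its image plays the role of the subsemigroup, and \<open>\<iota> (a, b)\<close> the
  role of its element \<open>(a, b)\<close>. No topology is prescribed on the pairs.
\<close>

definition ebic_embedding :: "(int \<times> int \<Rightarrow> 'a::semigroup_mult) \<Rightarrow> bool" where
  "ebic_embedding \<iota> \<longleftrightarrow> inj \<iota> \<and> (\<forall>x y. \<iota> (ebic_mult x y) = \<iota> x * \<iota> y)"

definition L_set :: "(int \<times> int \<Rightarrow> 'a::semigroup_mult) \<Rightarrow> 'a set" where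
  "L_set \<iota> = {x \<in> - range \<iota>. \<exists>y \<in> range \<iota>. x * y \<in> range \<iota>}"

definition R_set :: "(int \<times> int \<Rightarrow> 'a::semigroup_mult) \<Rightarrow> 'a set" where
  "R_set \<iota> = {x \<in> - range \<iota>. \<exists>y \<in> range \<iota>. y * x \<in> range \<iota>}"

definition up_ebic :: "(int \<times> int \<Rightarrow> 'a::semigroup_mult) \<Rightarrow> 'a set" where
  "up_ebic \<iota> = range \<iota> \<union> L_set \<iota>"

definition I_set :: "(int \<times> int \<Rightarrow> 'a::semigroup_mult) \<Rightarrow> 'a set" where
  "I_set \<iota> = - up_ebic \<iota>"

definition up_elem :: "(int \<times> int \<Rightarrow> 'a::semigroup_mult) \<Rightarrow> int \<Rightarrow> int \<Rightarrow> 'a set" where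
  "up_elem \<iota> a b = {x. x * \<iota> (b, b) = \<iota> (a, b)}"

definition subsemigroup :: "'a::semigroup_mult set \<Rightarrow> bool" where
  "subsemigroup S \<longleftrightarrow> S \<noteq> {} \<and> (\<forall>x \<in> S. \<forall>y \<in> S. x * y \<in> S)"

definition semigroup_ideal :: "'a::semigroup_mult set \<Rightarrow> 'a set \<Rightarrow> bool" where
  "semigroup_ideal J S \<longleftrightarrow>
     J \<noteq> {} \<and> J \<subseteq> S \<and> (\<forall>x \<in> J. \<forall>s \<in> S. s * x \<in> J \<and> x * s \<in> J)"

definition minimal_ideal :: "'a::semigroup_mult set \<Rightarrow> 'a set \<Rightarrow> bool" where
  "minimal_ideal J S \<longleftrightarrow>
     semigroup_ideal J S \<and> (\<forall>K. semigroup_ideal K S \<and> K \<subseteq> J \<longrightarrow> K = J)"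

text \<open>
  The monoid record with carrier \<open>S\<close>, the ambient multiplication, and \<open>e\<close> in the unit slot.
\<close>

definition mult_on :: "'a::semigroup_mult set \<Rightarrow> 'a \<Rightarrow> 'a monoid" where
  "mult_on S e = \<lparr>carrier = S, monoid.mult = (*), one = e\<rparr>"

text \<open>
  The identity \<open>e\<close> of a subgroup may be any idempotent of the semigroup.
\<close>

definition semigroup_subgroup :: "'a::semigroup_mult set \<Rightarrow> 'a set \<Rightarrow> bool" where
  "semigroup_subgroup G S \<longleftrightarrow> G \<subseteq> S \<and> (\<exists>e. group (mult_on G e))"

definition maximal_subgroup :: "'a::semigroup_mult set \<Rightarrow> 'a set \<Rightarrow> bool" where
  "maximal_subgroup G S \<longleftrightarrow>
     semigroup_subgroup G S \<and> (\<forall>K. semigroup_subgroup K S \<and> G \<subseteq> K \<longrightarrow> K = G)"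

definition group_of_units :: "'a::monoid_mult set" where
  "group_of_units = Units (mult_on UNIV 1)"

text \<open>Both properties concern the elements \<open>(n, m)\<close> of the copy that lie in \<open>U\<close>.\<close>

definition constant_difference_on :: "(int \<times> int \<Rightarrow> 'a) \<Rightarrow> 'a set \<Rightarrow> bool" where
  "constant_difference_on \<iota> U \<longleftrightarrow>
     (\<forall>n1 m1 n2 m2. \<iota> (n1, m1) \<in> U \<and> \<iota> (n2, m2) \<in> U \<longrightarrow> n1 - m1 = n2 - m2)"

definition coords_bounded_on :: "(int \<times> int \<Rightarrow> 'a) \<Rightarrow> 'a set \<Rightarrow> int \<Rightarrow> bool" where
  "coords_bounded_on \<iota> U N \<longleftrightarrow> (\<forall>p q. \<iota> (p, q) \<in> U \<longrightarrow> p \<le> N \<and> q \<le> N)"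

end

theory Submission
  imports Defs
begin

text \<open>
  Everything rests on the sets \<open>U a b = {x. (a,a) x (b,b) = (a,b)}\<close>. The identities
  \<open>(n,n) y = y\<close> and \<open>y (n,n) = y\<close> define closed sets, and \<open>(a,b)\<close> is the only pair
  \<open>y\<close> with \<open>(a,a) y (b,b) = y\<close> satisfying neither \<open>(a+1,a+1) y = y\<close> nor \<open>y (b+1,b+1) = y\<close>;
  by density, \<open>U a b\<close> is therefore open as well as closed. On the copy, \<open>U a b\<close> consists of
  the pairs \<open>(a-k,b-k)\<close> with \<open>k \<ge> 0\<close>, hence \<open>U a b - U (a-1) (b-1)\<close> is just
  \<open>{(a,b)}\<close>. So a point \<open>x\<close> of \<open>U a b\<close> outside the copy satisfies
  \<open>x (n,n) = (n+k,n)\<close> for all \<open>n\<close>, where \<open>k = a - b\<close>. Since \<open>1\<close> is a limit of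
  idempotents \<open>(n,n)\<close>, the integer \<open>k\<close> determines \<open>x\<close>; this makes the set \<open>L\<close> a
  submonoid of the integers.
\<close>

section \<open>Additively closed sets of integers\<close>

lemma int_add_closed_eq_multiples:
  fixes M :: "int set"
  assumes add: "\<And>x y. x \<in> M \<Longrightarrow> y \<in> M \<Longrightarrow> x + y \<in> M"
    and k: "k \<in> M" "- k \<in> M" "k \<noteq> 0"
  obtains n where "n > 0" "M = range ((*) n)"
proof -
  have zero: "0 \<in> M"
    using add[OF k(1,2)] by simp
  have nmult: "int j * x \<in> M" if "x \<in> M" for x j
    by (induction j) (use zero add that in \<open>auto simp: algebra_simps\<close>)
  have neg: "- x \<in> M" if "x \<in> M" for x
  proof -
    \<comment> \<open>This element is \<open>0\<close>, \<open>k\<close> or \<open>- k\<close>.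
      Adding \<open>\<bar>x\<bar>\<close> copies of it contributes
      \<open>- \<bar>k\<bar> * x\<close>, so together with only \<open>\<bar>k\<bar> - 1\<close>
      copies of \<open>x\<close> the sum is \<open>- x\<close>.\<close>
    have "- sgn x * \<bar>k\<bar> \<in> M"
      using k zero by (auto simp: sgn_if abs_if)
    then have "int (nat (\<bar>k\<bar> - 1)) * x + int (nat \<bar>x\<bar>) * (- sgn x * \<bar>k\<bar>) \<in> M"
      using add nmult that by blast
    moreover have "1 \<le> \<bar>k\<bar>"
      using k(3) by linarith
    then have "int (nat (\<bar>k\<bar> - 1)) * x + int (nat \<bar>x\<bar>) * (- sgn x * \<bar>k\<bar>) = - x"
      using \<open>1 \<le> \<bar>k\<bar>\<close> by (simp add: algebra_simps abs_mult_sgn)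
    ultimately show ?thesis
      by simp
  qed
  have mult: "j * x \<in> M" if "x \<in> M" for x j
    using nmult[OF that, of "nat \<bar>j\<bar>"] neg[OF nmult[OF that, of "nat \<bar>j\<bar>"]]
    by (cases "j \<ge> 0") auto
  define P where "P i \<longleftrightarrow> i > 0 \<and> int i \<in> M" for i
  define n where "n = Least P"
  have "P (nat \<bar>k\<bar>)"
    using k by (auto simp: P_def abs_if)
  then have n: "P n" and least: "\<And>i. P i \<Longrightarrow> n \<le> i"
    unfolding n_def by (auto intro: LeastI Least_le)
  have "int n dvd x" if "x \<in> M" for x
  proof -
    \<comment> \<open>The remainder stays in \<open>M\<close> and is smaller than the least positive
      member, so it vanishes.\<close>
    have "x mod int n = x + (- (x div int n)) * int n"
      by (simp add: minus_div_mult_eq_mod[symmetric])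
    with n that have "x mod int n \<in> M"
      by (metis P_def add mult)
    moreover have "0 \<le> x mod int n" "x mod int n < int n"
      using n by (auto simp: P_def)
    ultimately have "x mod int n = 0"
      using least[of "nat (x mod int n)"] by (fastforce simp: P_def)
    then show ?thesis
      by auto
  qed
  moreover have "int n * j \<in> M" for j
    using mult[of "int n" j] n by (simp add: P_def mult.commute)
  ultimately have "M = range ((*) (int n))"
    by blast
  with n show ?thesis
    by (intro that[of "int n"]) (auto simp: P_def)
qed

lemma multiples_iso_integer_group:
  assumes "n \<noteq> 0"
  shows "integer_group\<lparr>carrier := range ((*) n)\<rparr> \<cong> integer_group"
proof (rule is_isoI, rule isoI)
  show "(\<lambda>x. x div n) \<in> hom (integer_group\<lparr>carrier := range ((*) n)\<rparr>) integer_group"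
    using assms by (auto simp: hom_def integer_group_def distrib_left[symmetric])
  show "bij_betw (\<lambda>x. x div n) (carrier (integer_group\<lparr>carrier := range ((*) n)\<rparr>)) (carrier integer_group)"
    using assms by (auto simp: bij_betw_def inj_on_def integer_group_def image_image)
qed

section \<open>Continuity and density\<close>

locale dense_ebic =
  fixes \<iota> :: "int \<times> int \<Rightarrow> 'a::{t2_space, topological_semigroup_mult, monoid_mult}"
  assumes embedding: "ebic_embedding \<iota>"
    and dense: "closure (range \<iota>) = UNIV"
begin

lemma emb_mult: "\<iota> x * \<iota> y = \<iota> (ebic_mult x y)"
  using embedding unfolding ebic_embedding_def by metis

lemma emb_mult_left: "\<iota> x * (\<iota> y * z) = \<iota> (ebic_mult x y) * z"
  by (simp add: emb_mult flip: mult.assoc)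

lemma emb_eq_iff [simp]: "\<iota> x = \<iota> y \<longleftrightarrow> x = y"
  using embedding by (simp add: ebic_embedding_def inj_eq)

lemma continuous_mult:
  fixes f g :: "'b::topological_space \<Rightarrow> 'a"
  shows "continuous_on S f \<Longrightarrow> continuous_on S g \<Longrightarrow> continuous_on S (\<lambda>x. f x * g x)"
  unfolding continuous_on_def by (auto intro: tendsto_mult)

lemmas continuous_translation = continuous_mult continuous_on_const continuous_on_id

lemma open_meets_copy:
  assumes "open W" "x \<in> W"
  obtains p where "\<iota> p \<in> W"
proof -
  have "W \<inter> range \<iota> \<noteq> {}"
    using assms dense open_Int_closure_eq_empty[OF assms(1), of "range \<iota>"] by auto
  with that show ?thesis
    by blast
qed

text \<open>In a Hausdorff space the points where \<open>f\<close> and \<open>g\<close> differ form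
  an open set; if it met \<open>W\<close>, density would put a point of the copy in the
  intersection. Identities thus pass from the copy to all of \<open>W\<close>.\<close>

lemma eq_on_open_by_density:
  fixes f g :: "'a \<Rightarrow> 'a"
  assumes "open W" "x \<in> W" "continuous_on UNIV f" "continuous_on UNIV g"
    and "\<And>a b. \<iota> (a, b) \<in> W \<Longrightarrow> f (\<iota> (a, b)) = g (\<iota> (a, b))"
  shows "f x = g x"
proof (rule ccontr)
  assume "f x \<noteq> g x"
  moreover have "open (W \<inter> {x. f x \<noteq> g x})"
    using assms by (intro open_Int open_Collect_neq) auto
  ultimately obtain p where "\<iota> p \<in> W" "f (\<iota> p) \<noteq> g (\<iota> p)"
    using open_meets_copy[of "W \<inter> {x. f x \<noteq> g x}" x] \<open>x \<in> W\<close> by blast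
  with assms(5) show False
    by (cases p) auto
qed

section \<open>The closed-and-open sets \<open>U a b\<close>\<close>

definition U :: "int \<Rightarrow> int \<Rightarrow> 'a set" where
  "U a b = {x. \<iota> (a, a) * x * \<iota> (b, b) = \<iota> (a, b)}"

lemma emb_in_U_iff: "\<iota> (c, d) \<in> U a b \<longleftrightarrow> c - d = a - b \<and> c \<le> a"
  by (auto simp: U_def emb_mult split: if_splits)

lemma emb_in_U: "\<iota> (a, b) \<in> U a b"
  by (simp add: emb_in_U_iff)

lemma closed_U: "closed (U a b)"
  unfolding U_def by (intro closed_Collect_eq continuous_translation)

lemma open_U: "open (U a b)"
proof -
  define f where "f x = \<iota> (a, a) * x * \<iota> (b, b)" for x
  \<comment> \<open>On the copy, \<open>f\<close> takes values \<open>(c, d)\<close> with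
    \<open>c \<ge> a\<close> and \<open>d \<ge> b\<close>. The first inequality defining
    \<open>W\<close> then says \<open>c = a\<close>, the second \<open>d = b\<close>.\<close>
  define W where "W = {x. \<iota> (a + 1, a + 1) * f x \<noteq> f x} \<inter> {x. f x * \<iota> (b + 1, b + 1) \<noteq> f x}"
  have cont: "continuous_on UNIV f"
    unfolding f_def by (intro continuous_translation)
  have W: "open W"
    unfolding W_def
    by (intro open_Int open_Collect_neq continuous_mult continuous_on_const cont)
  have "f x = \<iota> (a, b)" if "x \<in> W" for x
    by (rule eq_on_open_by_density[OF W that cont])
      (auto simp: W_def f_def emb_mult intro!: continuous_on_const split: if_splits)
  then have "U a b = W"
    by (auto simp: W_def U_def f_def emb_mult)
  with W show ?thesis
    by simp
qed

text \<open>Pairs of the copy in \<open>U a b\<close> have second coordinate at most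
  \<open>b\<close> and difference \<open>a - b\<close>, so \<open>(b, b)\<close> sends all of them
  to \<open>(a, b)\<close>; openness of \<open>U a b\<close> extends this to every point.\<close>

lemma in_U_iff_right: "x \<in> U a b \<longleftrightarrow> x * \<iota> (b, b) = \<iota> (a, b)"
proof
  show "x * \<iota> (b, b) = \<iota> (a, b)" if "x \<in> U a b"
    by (rule eq_on_open_by_density[OF open_U that])
      (auto intro!: continuous_translation simp: emb_in_U_iff emb_mult)
qed (simp add: U_def emb_mult mult.assoc)

lemma in_U_iff_left: "x \<in> U a b \<longleftrightarrow> \<iota> (a, a) * x = \<iota> (a, b)"
proof
  show "\<iota> (a, a) * x = \<iota> (a, b)" if "x \<in> U a b"
    by (rule eq_on_open_by_density[OF open_U that])
      (auto intro!: continuous_translation simp: emb_in_U_iff emb_mult)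
qed (simp add: U_def emb_mult)

lemma up_elem_eq_U: "up_elem \<iota> a b = U a b"
  by (auto simp: up_elem_def in_U_iff_right)

text \<open>The indices compose as for arrows: \<open>y\<close> turns \<open>(c, c)\<close> into
  \<open>(b, c)\<close>, which absorbs \<open>(b, b)\<close> on its left, and \<open>x\<close> then
  acts on that idempotent.\<close>

lemma U_mult:
  assumes "x \<in> U a b" "y \<in> U b c"
  shows "x * y \<in> U a c"
proof -
  have "x * y * \<iota> (c, c) = x * \<iota> (b, b) * \<iota> (b, c)"
    using assms(2) by (simp add: in_U_iff_right emb_mult mult.assoc)
  with assms(1) show ?thesis
    by (simp add: in_U_iff_right emb_mult)
qed

lemma U_mono:
  assumes "x \<in> U a b" "j \<ge> 0"
  shows "x \<in> U (a + j) (b + j)"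
proof -
  have "x * \<iota> (b + j, b + j) = x * \<iota> (b, b) * \<iota> (b + j, b + j)"
    using assms(2) by (simp add: emb_mult mult.assoc)
  with assms show ?thesis
    by (simp add: in_U_iff_right emb_mult)
qed

section \<open>Points outside the copy as integer shifts\<close>

lemma U_step_down:
  assumes "x \<in> U a b" "x \<noteq> \<iota> (a, b)"
  shows "x \<in> U (a - 1) (b - 1)"
proof (rule ccontr)
  assume "x \<notin> U (a - 1) (b - 1)"
  with assms(1) have x: "x \<in> U a b - U (a - 1) (b - 1)"
    by simp
  have "x = \<iota> (a, b)"
    by (rule eq_on_open_by_density[OF open_Diff[OF open_U closed_U] x])
      (auto intro!: continuous_on_const continuous_on_id simp: emb_in_U_iff)
  with assms(2) show False ..
qed

text \<open>By \<open>in_U_iff_right\<close>, \<open>x\<close> translates the first coordinate of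
  every idempotent \<open>(b, b)\<close> by \<open>k\<close>. Asking this for arbitrarily small
  \<open>b\<close> excludes the points of the copy.\<close>

definition shift_by :: "int \<Rightarrow> 'a \<Rightarrow> bool" where
  "shift_by k x \<longleftrightarrow> (\<forall>b. x \<in> U (b + k) b)"

text \<open>Upwards, \<open>U_mono\<close> applies; downwards, \<open>U_step_down\<close> could stop
  only at a point of the copy, so the descent never ends.\<close>

lemma shift_byI:
  assumes "x \<in> U a b" "x \<notin> range \<iota>"
  shows "shift_by (a - b) x"
  unfolding shift_by_def
proof
  fix c
  have down: "x \<in> U (a - int j) (b - int j)" for j
  proof (induction j)
    case (Suc j)
    moreover have "x \<noteq> \<iota> (a - int j, b - int j)"
      using assms(2) by blast
    ultimately show ?case
      using U_step_down by (fastforce simp: algebra_simps)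
  qed (simp add: assms(1))
  show "x \<in> U (c + (a - b)) c"
  proof (cases "c \<ge> b")
    case True
    with U_mono[OF assms(1), of "c - b"] show ?thesis
      by (simp add: algebra_simps)
  next
    case False
    with down[of "nat (b - c)"] show ?thesis
      by (simp add: algebra_simps)
  qed
qed

lemma shift_by_right: "shift_by k x \<Longrightarrow> x * \<iota> (b, b) = \<iota> (b + k, b)"
  by (simp add: shift_by_def in_U_iff_right)

lemma shift_by_inj_left: "shift_by k x \<Longrightarrow> shift_by l x \<Longrightarrow> k = l"
  using shift_by_right[of k x 0] shift_by_right[of l x 0] by simp

lemma shift_by_notin_range: "shift_by k x \<Longrightarrow> x \<notin> range \<iota>"
proof
  assume "shift_by k x" "x \<in> range \<iota>"
  then obtain c d where "x = \<iota> (c, d)"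
    by auto
  \<comment> \<open>Taking \<open>b = d - 1\<close> goes one index too low: equal differences give
    \<open>c = d + k\<close>, whereas membership demands \<open>c \<le> d - 1 + k\<close>.\<close>
  then have "\<iota> (c, d) \<in> U (d - 1 + k) (d - 1)"
    using \<open>shift_by k x\<close> shift_by_def by blast
  then show False
    unfolding emb_in_U_iff by linarith
qed

lemma shift_by_mult:
  assumes "shift_by k x" "shift_by l y"
  shows "shift_by (k + l) (x * y)"
  unfolding shift_by_def
proof
  fix b
  have "x \<in> U (b + l + k) (b + l)" "y \<in> U (b + l) b"
    using assms by (auto simp: shift_by_def)
  from U_mult[OF this] show "x * y \<in> U (b + (k + l)) b"
    by (simp add: algebra_simps)
qed

lemma one_shift_by: "shift_by 0 1"
  by (simp add: shift_by_def in_U_iff_right)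

text \<open>The copy meets the neighbourhood \<open>U 0 0\<close> of \<open>1\<close> only in
  idempotents, on which \<open>x\<close> and \<open>y\<close> act alike; by density they also act
  alike on \<open>1\<close>.\<close>

lemma shift_by_unique:
  assumes "shift_by k x" "shift_by k y"
  shows "x = y"
proof -
  have "x * 1 = y * 1"
  proof (rule eq_on_open_by_density[OF open_U, where f = "(*) x" and g = "(*) y"])
    show "1 \<in> U 0 0"
      by (simp add: in_U_iff_right)
    show "x * \<iota> (a, b) = y * \<iota> (a, b)" if "\<iota> (a, b) \<in> U 0 0" for a b
      using that assms by (simp add: emb_in_U_iff shift_by_right)
  qed (intro continuous_translation)+
  then show ?thesis
    by simp
qed

section \<open>The sets \<open>L\<close> and \<open>R\<close> in terms of \<open>U\<close>\<close>

lemma ex_U_iff_right: "(\<exists>a b. x \<in> U a b) \<longleftrightarrow> (\<exists>y \<in> range \<iota>. x * y \<in> range \<iota>)"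
proof
  assume "\<exists>y \<in> range \<iota>. x * y \<in> range \<iota>"
  then obtain c d p q where eq: "x * \<iota> (c, d) = \<iota> (p, q)"
    by auto
  obtain r s where rs: "ebic_mult (p, q) (d, c) = (r, s)"
    by fastforce
  \<comment> \<open>Multiplying by the inverse pair \<open>(d, c)\<close> replaces
    \<open>(c, d)\<close> by the idempotent \<open>(c, c)\<close>.\<close>
  have xc: "x * \<iota> (c, c) = \<iota> (r, s)"
    using arg_cong[OF eq, of "\<lambda>z. z * \<iota> (d, c)"] rs by (simp add: emb_mult mult.assoc)
  \<comment> \<open>Being fixed by \<open>(c, c)\<close> on the right forces
    \<open>c \<le> s\<close>; hence \<open>(c, c)\<close> absorbs into \<open>(s, s)\<close>, and
    \<open>x\<close> lies in \<open>U r s\<close>.\<close>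
  have "\<iota> (r, s) * \<iota> (c, c) = x * (\<iota> (c, c) * \<iota> (c, c))"
    by (simp add: mult.assoc flip: xc)
  also have "\<dots> = \<iota> (r, s)"
    by (simp add: xc emb_mult)
  finally have "c \<le> s"
    by (auto simp: emb_mult split: if_splits)
  then have "x * \<iota> (s, s) = \<iota> (r, s)"
    using arg_cong[OF xc, of "\<lambda>z. z * \<iota> (s, s)"]
    by (auto simp: emb_mult mult.assoc split: if_splits)
  then show "\<exists>a b. x \<in> U a b"
    by (auto simp: in_U_iff_right)
qed (auto simp: in_U_iff_right)

lemma ex_U_iff_left: "(\<exists>a b. x \<in> U a b) \<longleftrightarrow> (\<exists>y \<in> range \<iota>. y * x \<in> range \<iota>)"
proof
  assume "\<exists>y \<in> range \<iota>. y * x \<in> range \<iota>"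
  then obtain c d p q where eq: "\<iota> (c, d) * x = \<iota> (p, q)"
    by auto
  obtain r s where rs: "ebic_mult (d, c) (p, q) = (r, s)"
    by fastforce
  have xd: "\<iota> (d, d) * x = \<iota> (r, s)"
    using arg_cong[OF eq, of "\<lambda>z. \<iota> (d, c) * z"] rs by (simp add: emb_mult emb_mult_left)
  have "\<iota> (d, d) * \<iota> (r, s) = \<iota> (d, d) * \<iota> (d, d) * x"
    by (simp add: mult.assoc flip: xd)
  also have "\<dots> = \<iota> (r, s)"
    by (simp add: xd emb_mult)
  finally have "d \<le> r"
    by (auto simp: emb_mult split: if_splits)
  then have "\<iota> (r, r) * x = \<iota> (r, s)"
    using arg_cong[OF xd, of "\<lambda>z. \<iota> (r, r) * z"]
    by (auto simp: emb_mult emb_mult_left split: if_splits)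
  then show "\<exists>a b. x \<in> U a b"
    by (auto simp: in_U_iff_left)
qed (auto simp: in_U_iff_left)

lemma L_set_iff_U: "x \<in> L_set \<iota> \<longleftrightarrow> x \<notin> range \<iota> \<and> (\<exists>a b. x \<in> U a b)"
  unfolding ex_U_iff_right by (simp add: L_set_def)

lemma L_set_eq_R_set: "L_set \<iota> = R_set \<iota>"
  using ex_U_iff_right ex_U_iff_left by (simp add: L_set_def R_set_def)

lemma L_set_iff: "x \<in> L_set \<iota> \<longleftrightarrow> (\<exists>k. shift_by k x)"
  unfolding L_set_iff_U using shift_byI shift_by_notin_range shift_by_def by meson

lemma up_ebic_iff: "x \<in> up_ebic \<iota> \<longleftrightarrow> (\<exists>a b. x \<in> U a b)"
  using emb_in_U by (auto simp: up_ebic_def L_set_iff_U)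

section \<open>Products and ideals\<close>

lemma up_ebic_mult:
  assumes "x \<in> up_ebic \<iota>" "y \<in> up_ebic \<iota>"
  shows "x * y \<in> up_ebic \<iota>"
proof -
  obtain a b c d where "x \<in> U a b" "y \<in> U c d"
    using assms by (auto simp: up_ebic_iff)
  \<comment> \<open>Both index pairs are raised until the inner indices agree, as
    \<open>U_mult\<close> requires.\<close>
  then have "x \<in> U (a + (max b c - b)) (max b c)" "y \<in> U (max b c) (d + (max b c - c))"
    using U_mono[of x a b "max b c - b"] U_mono[of y c d "max b c - c"] by auto
  then show ?thesis
    using U_mult up_ebic_iff by blast
qed

lemma range_mult_up_ebic:
  assumes "x \<in> range \<iota>" "s \<in> up_ebic \<iota>"
  shows "s * x \<in> range \<iota>" "x * s \<in> range \<iota>"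
proof -
  obtain c d where x: "x = \<iota> (c, d)"
    using assms by auto
  have "s * x \<in> range \<iota> \<and> x * s \<in> range \<iota>"
  proof (cases "s \<in> range \<iota>")
    case True
    with x show ?thesis
      by (auto simp: emb_mult)
  next
    case False
    with assms obtain k where k: "shift_by k s"
      by (auto simp: up_ebic_def L_set_iff)
    \<comment> \<open>The instances \<open>c\<close> and \<open>d - k\<close> fit the two
      idempotents in \<open>(c, d) = (c, c) (c, d) = (c, d) (d, d)\<close>.\<close>
    then have "s \<in> U (c + k) c" "s \<in> U (d - k + k) (d - k)"
      unfolding shift_by_def by blast+
    then have "s * \<iota> (c, c) = \<iota> (c + k, c)" "\<iota> (d, d) * s = \<iota> (d, d - k)"
      using in_U_iff_right in_U_iff_left by auto
    then have "s * \<iota> (c, c) * \<iota> (c, d) \<in> range \<iota>" "\<iota> (c, d) * (\<iota> (d, d) * s) \<in> range \<iota>"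
      by (auto simp: emb_mult)
    with x show ?thesis
      by (simp add: emb_mult emb_mult_left mult.assoc)
  qed
  then show "s * x \<in> range \<iota>" "x * s \<in> range \<iota>"
    by auto
qed

lemma minimal_ideal_range: "minimal_ideal (range \<iota>) (up_ebic \<iota>)"
  unfolding minimal_ideal_def
proof (intro conjI allI impI)
  show "semigroup_ideal (range \<iota>) (up_ebic \<iota>)"
    using range_mult_up_ebic by (auto simp: semigroup_ideal_def up_ebic_def)
next
  fix K
  assume K: "semigroup_ideal K (up_ebic \<iota>) \<and> K \<subseteq> range \<iota>"
  then obtain p q where pq: "\<iota> (p, q) \<in> K"
    by (fastforce simp: semigroup_ideal_def)
  have "\<iota> (a, b) \<in> K" for a b
  proof -
    have "\<iota> (a, p) \<in> up_ebic \<iota>" "\<iota> (q, b) \<in> up_ebic \<iota>"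
      by (auto simp: up_ebic_def)
    \<comment> \<open>The product equals \<open>(a, b)\<close>, so a single pair in \<open>K\<close>
      generates the whole copy.\<close>
    with K pq have "\<iota> (a, p) * \<iota> (p, q) * \<iota> (q, b) \<in> K"
      by (auto simp: semigroup_ideal_def)
    then show ?thesis
      by (simp add: emb_mult)
  qed
  with K show "K = range \<iota>"
    by auto
qed

lemma open_up_ebic: "open (up_ebic \<iota>)"
  using open_U up_ebic_iff by (subst open_subopen) (metis subsetI)

text \<open>
  The other factor may be moved into the copy because \<open>up_ebic\<close> is open; the product
  with an idempotent then lands in the copy.
\<close>

lemma up_ebic_right_factor:
  assumes "s * x \<in> up_ebic \<iota>"
  shows "x \<in> up_ebic \<iota>"
proof -
  have "open ((\<lambda>s. s * x) -` up_ebic \<iota>)"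
    by (intro open_vimage open_up_ebic continuous_translation)
  moreover have "s \<in> (\<lambda>s. s * x) -` up_ebic \<iota>"
    using assms by simp
  ultimately obtain p where "\<iota> p \<in> (\<lambda>s. s * x) -` up_ebic \<iota>"
    by (rule open_meets_copy)
  then obtain a b where "\<iota> p * x \<in> U a b"
    by (auto simp: up_ebic_iff)
  then have "\<iota> (ebic_mult (a, a) p) * x = \<iota> (a, b)"
    unfolding in_U_iff_left emb_mult_left .
  then have "\<exists>y \<in> range \<iota>. y * x \<in> range \<iota>"
    by (metis rangeI)
  then show ?thesis
    unfolding up_ebic_iff ex_U_iff_left .
qed

lemma up_ebic_left_factor:
  assumes "x * s \<in> up_ebic \<iota>"
  shows "x \<in> up_ebic \<iota>"
proof -
  have "open ((\<lambda>s. x * s) -` up_ebic \<iota>)"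
    by (intro open_vimage open_up_ebic continuous_translation)
  moreover have "s \<in> (\<lambda>s. x * s) -` up_ebic \<iota>"
    using assms by simp
  ultimately obtain p where "\<iota> p \<in> (\<lambda>s. x * s) -` up_ebic \<iota>"
    by (rule open_meets_copy)
  then obtain a b where "x * \<iota> p \<in> U a b"
    by (auto simp: up_ebic_iff)
  then have "x * \<iota> (ebic_mult p (b, b)) = \<iota> (a, b)"
    unfolding in_U_iff_right mult.assoc emb_mult .
  then have "\<exists>y \<in> range \<iota>. x * y \<in> range \<iota>"
    by (metis rangeI)
  then show ?thesis
    unfolding up_ebic_iff ex_U_iff_right .
qed

text \<open>This is the contrapositive of the two factor lemmas.\<close>

lemma I_set_ideal: "I_set \<iota> \<noteq> {} \<Longrightarrow> semigroup_ideal (I_set \<iota>) UNIV"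
  unfolding semigroup_ideal_def I_set_def
  using up_ebic_right_factor up_ebic_left_factor by blast

section \<open>The semigroup \<open>L\<close> and its neighbourhoods\<close>

lemma one_in_L_set: "1 \<in> L_set \<iota>"
  using one_shift_by L_set_iff by blast

lemma L_set_mult: "x \<in> L_set \<iota> \<Longrightarrow> y \<in> L_set \<iota> \<Longrightarrow> x * y \<in> L_set \<iota>"
  using shift_by_mult L_set_iff by metis

lemma L_set_subsemigroup: "subsemigroup (L_set \<iota>)"
  using one_in_L_set L_set_mult by (auto simp: subsemigroup_def)

lemma L_set_neighbourhood:
  assumes "x \<in> L_set \<iota>"
  obtains V N where "open V" "x \<in> V" "constant_difference_on \<iota> V" "coords_bounded_on \<iota> V N"
proof -
  obtain a b where "x \<in> U a b"
    using assms by (auto simp: L_set_iff_U)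
  moreover have "constant_difference_on \<iota> (U a b)" "coords_bounded_on \<iota> (U a b) (max a b)"
    by (auto simp: constant_difference_on_def coords_bounded_on_def emb_in_U_iff)
  ultimately show ?thesis
    using that open_U by blast
qed

text \<open>Once \<open>N\<close> bounds the coordinates, the product of a pair in \<open>V\<close>
  with \<open>(N, N)\<close> depends only on the difference of the pair. It is therefore constant on
  the copy within \<open>V\<close>, and density gives the same value at \<open>x\<close>.\<close>

lemma L_setI:
  assumes "x \<notin> range \<iota>" "open V" "x \<in> V" "constant_difference_on \<iota> V" "coords_bounded_on \<iota> V N"
  shows "x \<in> L_set \<iota>"
proof -
  obtain c d where cd: "\<iota> (c, d) \<in> V"
    using open_meets_copy[OF assms(2,3)] by auto
  have "x * \<iota> (N, N) = \<iota> (N + (c - d), N)"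
  proof (rule eq_on_open_by_density[OF assms(2,3)])
    fix a b
    assume ab: "\<iota> (a, b) \<in> V"
    then have "a - b = c - d" "b \<le> N"
      using assms(4,5) cd unfolding constant_difference_on_def coords_bounded_on_def by blast+
    then show "\<iota> (a, b) * \<iota> (N, N) = \<iota> (N + (c - d), N)"
      by (auto simp: emb_mult)
  qed (intro continuous_translation)+
  then have "x \<in> U (N + (c - d)) N"
    by (simp add: in_U_iff_right)
  with assms(1) show ?thesis
    unfolding L_set_iff_U by blast
qed

lemma up_elem_Int_L_set:
  "is_singleton (up_elem \<iota> a b \<inter> L_set \<iota>) \<or> up_elem \<iota> a b \<inter> L_set \<iota> = {}"
proof (cases "up_elem \<iota> a b \<inter> L_set \<iota> = {}")
  case False
  have "shift_by (a - b) x" if "x \<in> up_elem \<iota> a b \<inter> L_set \<iota>" for x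
    using that shift_byI by (auto simp: up_elem_eq_U L_set_def)
  with False show ?thesis
    using shift_by_unique by (metis is_singletonI')
qed simp

section \<open>The monoid of shifts and subgroups of \<open>L\<close>\<close>

definition shifts :: "int set" where
  "shifts = {k. \<exists>x. shift_by k x}"

lemma shifts_submonoid: "submonoid shifts integer_group"
proof
  show "x \<otimes>\<^bsub>integer_group\<^esub> y \<in> shifts" if "x \<in> shifts" "y \<in> shifts" for x y
    using that shift_by_mult unfolding shifts_def mult_integer_group by blast
qed (use one_shift_by in \<open>auto simp: shifts_def\<close>)

text \<open>The isomorphism sends an element to its shift: \<open>shift_by_inj_left\<close> makes
  this well defined, \<open>shift_by_unique\<close> injective, and \<open>shift_by_mult\<close>
  additive.\<close>

lemma L_set_iso_shifts: "mult_on (L_set \<iota>) 1 \<cong> integer_group\<lparr>carrier := shifts\<rparr>"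
proof (rule is_isoI, rule isoI)
  let ?h = "\<lambda>x. THE k. shift_by k x"
  have h: "?h x = k" if "shift_by k x" for x k
    using that shift_by_inj_left by blast
  show "?h \<in> hom (mult_on (L_set \<iota>) 1) (integer_group\<lparr>carrier := shifts\<rparr>)"
    using h shift_by_mult
    by (fastforce simp: hom_def mult_on_def integer_group_def L_set_iff shifts_def)
  have "inj_on ?h (L_set \<iota>)"
    by (rule inj_onI) (metis L_set_iff h shift_by_unique)
  moreover have "?h ` L_set \<iota> = shifts"
    using h by (force simp: L_set_iff shifts_def)
  ultimately show "bij_betw ?h (carrier (mult_on (L_set \<iota>) 1)) (carrier (integer_group\<lparr>carrier := shifts\<rparr>))"
    by (simp add: bij_betw_def mult_on_def)
qed

lemma shifts_eq_multiples:
  assumes "shift_by k x" "shift_by (- k) y" "k \<noteq> 0"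
  obtains n where "n > 0" "shifts = range ((*) n)"
  using int_add_closed_eq_multiples[of shifts k] assms submonoid.m_closed[OF shifts_submonoid]
  unfolding shifts_def by auto

lemma shift_by_inverse:
  assumes "shift_by k x" "shift_by l y" "x * y = 1"
  shows "l = - k"
  using shift_by_inj_left[OF shift_by_mult[OF assms(1,2)], of 0] assms(3) one_shift_by by simp

text \<open>The identity of \<open>G\<close> is idempotent, so its shift is \<open>0\<close> and it
  equals \<open>1\<close>. Another element and its inverse have opposite nonzero shifts, which makes
  the shifts a group of multiples.\<close>

lemma L_set_iso_integer_group:
  assumes "semigroup_subgroup G (L_set \<iota>)" "\<not> is_singleton G"
  shows "mult_on (L_set \<iota>) 1 \<cong> integer_group"
proof -
  obtain e where G: "G \<subseteq> L_set \<iota>" "group (mult_on G e)"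
    using assms(1) by (auto simp: semigroup_subgroup_def)
  then interpret group "mult_on G e"
    by simp
  have e: "e \<in> G" "e * e = e"
    using one_closed l_one[OF one_closed] by (simp_all add: mult_on_def)
  then obtain l where l: "shift_by l e"
    using G(1) L_set_iff by blast
  then have "l = 0"
    using shift_by_inj_left[OF shift_by_mult[OF l l], of l] e by simp
  with l have "e = 1"
    using shift_by_unique one_shift_by by blast
  with assms(2) e obtain x where x: "x \<in> G" "x \<noteq> 1"
    by (metis empty_iff is_singletonI')
  then obtain y where y: "y \<in> G" "x * y = 1"
    using r_inv_ex[of x] \<open>e = 1\<close> by (auto simp: mult_on_def)
  obtain k k' where k: "shift_by k x" "shift_by k' y"
    using x y G L_set_iff by blast
  have "k \<noteq> 0"
    using k x shift_by_unique one_shift_by by blast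
  moreover have "k' = - k"
    using shift_by_inverse[OF k y(2)] .
  ultimately obtain n where n: "n > 0" "shifts = range ((*) n)"
    using shifts_eq_multiples k by metis
  then have "integer_group\<lparr>carrier := shifts\<rparr> \<cong> integer_group"
    using multiples_iso_integer_group[of n] by simp
  with L_set_iso_shifts show ?thesis
    by (rule iso_trans)
qed

section \<open>The group of units\<close>

lemma group_of_units_iff:
  "x \<in> (group_of_units :: 'a set) \<longleftrightarrow> (\<exists>y. y * x = 1 \<and> x * y = 1)"
  by (auto simp: group_of_units_def Units_def mult_on_def)

lemma group_of_units_subset_L_set: "(group_of_units :: 'a set) \<subseteq> L_set \<iota>"
proof
  fix x :: 'a
  assume "x \<in> group_of_units"
  then obtain y where y: "y * x = 1" "x * y = 1"
    by (auto simp: group_of_units_iff)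
  have one: "1 \<in> up_ebic \<iota>" "1 \<notin> range \<iota>"
    using one_in_L_set by (auto simp: up_ebic_def L_set_def)
  \<comment> \<open>Factors of \<open>1\<close> lie in \<open>up_ebic\<close>. If \<open>x\<close>
    were in the copy, which is an ideal there, then so would be \<open>x * y = 1\<close>.\<close>
  then have "x \<in> up_ebic \<iota>" "y \<in> up_ebic \<iota>"
    using y up_ebic_left_factor by metis+
  moreover have "x \<notin> range \<iota>"
    using range_mult_up_ebic(2)[of x y] y one \<open>y \<in> up_ebic \<iota>\<close> by auto
  ultimately show "x \<in> L_set \<iota>"
    by (auto simp: up_ebic_def)
qed

text \<open>A unit other than \<open>1\<close> makes the shifts closed under negation. Elements of
  opposite shifts multiply to shift \<open>0\<close>, hence to \<open>1\<close>, so every element of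
  \<open>L\<close> is invertible.\<close>

lemma group_of_units_eq_L_set:
  assumes "\<not> is_singleton (group_of_units :: 'a set)"
  shows "(group_of_units :: 'a set) = L_set \<iota>"
proof
  have "1 \<in> (group_of_units :: 'a set)"
    by (simp add: group_of_units_iff)
  with assms obtain x :: 'a where x: "x \<in> group_of_units" "x \<noteq> 1"
    by (metis empty_iff is_singletonI')
  then obtain y where y: "y * x = 1" "x * y = 1"
    by (auto simp: group_of_units_iff)
  with x have "y \<in> group_of_units"
    by (auto simp: group_of_units_iff)
  with x obtain k l where k: "shift_by k x" "shift_by l y"
    using group_of_units_subset_L_set L_set_iff by blast
  have "k \<noteq> 0"
    using k x shift_by_unique one_shift_by by blast
  moreover have "l = - k"
    using shift_by_inverse[OF k y(2)] .
  ultimately obtain n where n: "shifts = range ((*) n)"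
    using shifts_eq_multiples k by metis
  show "L_set \<iota> \<subseteq> (group_of_units :: 'a set)"
  proof
    fix z
    assume "z \<in> L_set \<iota>"
    then obtain m where m: "shift_by m z"
      by (auto simp: L_set_iff)
    then obtain j where "m = n * j"
      using n by (auto simp: shifts_def)
    then have "- m = n * (- j)"
      by simp
    then have "- m \<in> shifts"
      unfolding n by (rule range_eqI)
    then obtain w where w: "shift_by (- m) w"
      by (auto simp: shifts_def)
    have "w * z = 1" "z * w = 1"
      using shift_by_mult[OF w m] shift_by_mult[OF m w] shift_by_unique one_shift_by by auto
    then show "z \<in> group_of_units"
      by (auto simp: group_of_units_iff)
  qed
qed (rule group_of_units_subset_L_set)

end

section \<open>The structure of the closure of the copy\<close>

theorem proposition3p8:
  fixes \<iota> :: "int \<times> int \<Rightarrow> 'a::{t2_space, topological_semigroup_mult, monoid_mult}"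
  assumes embedding: "ebic_embedding \<iota>"
    and dense: "closure (range \<iota>) = UNIV"
  shows
    \<comment> \<open>(i)\<close>
    "(L_set \<iota> \<noteq> {} \<longrightarrow>
        subsemigroup (L_set \<iota>) \<and>
        (\<forall>a \<in> L_set \<iota>. \<exists>U. open U \<and> a \<in> U \<and> constant_difference_on \<iota> U)) \<and>
    \<comment> \<open>(ii)\<close>
     (R_set \<iota> \<noteq> {} \<longrightarrow>
        subsemigroup (R_set \<iota>) \<and>
        (\<forall>a \<in> R_set \<iota>. \<exists>U. open U \<and> a \<in> U \<and> constant_difference_on \<iota> U)) \<and>
    \<comment> \<open>(iii)\<close>
     ((L_set \<iota> \<noteq> {} \<longrightarrow>
        (\<forall>a \<in> L_set \<iota>. \<exists>U n\<^sub>a. open U \<and> a \<in> U \<and> coords_bounded_on \<iota> U n\<^sub>a)) \<and>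
      (R_set \<iota> \<noteq> {} \<longrightarrow>
        (\<forall>a \<in> R_set \<iota>. \<exists>U n\<^sub>a. open U \<and> a \<in> U \<and> coords_bounded_on \<iota> U n\<^sub>a))) \<and>
    \<comment> \<open>(iv)\<close>
     (L_set \<iota> = R_set \<iota>) \<and>
    \<comment> \<open>(v)\<close>
     (subsemigroup (up_ebic \<iota>) \<and> minimal_ideal (range \<iota>) (up_ebic \<iota>)) \<and>
    \<comment> \<open>(vi)\<close>
     (\<forall>a. a \<notin> range \<iota> \<and>
        (\<exists>U. open U \<and> a \<in> U \<and> constant_difference_on \<iota> U \<and>
          (\<exists>n\<^sub>a. coords_bounded_on \<iota> U n\<^sub>a)) \<longrightarrow>
        a \<in> L_set \<iota>) \<and>
    \<comment> \<open>(vii)\<close>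
     (I_set \<iota> \<noteq> {} \<longrightarrow> semigroup_ideal (I_set \<iota>) UNIV) \<and>
    \<comment> \<open>(viii)\<close>
     (\<forall>a b.
        {x. x * \<iota> (b, b) = \<iota> (a, b)} = {x. \<iota> (a, a) * x = \<iota> (a, b)} \<and>
        {x. \<iota> (a, a) * x = \<iota> (a, b)} = {x. \<iota> (a, a) * x * \<iota> (b, b) = \<iota> (a, b)} \<and>
        closed (up_elem \<iota> a b) \<and> open (up_elem \<iota> a b)) \<and>
    \<comment> \<open>(ix)\<close>
     (\<forall>a b. is_singleton (up_elem \<iota> a b \<inter> L_set \<iota>) \<or> up_elem \<iota> a b \<inter> L_set \<iota> = {}) \<and>
    \<comment> \<open>(x)\<close>
     ((\<exists>M. submonoid M integer_group \<and>
        mult_on (L_set \<iota>) 1 \<cong> integer_group\<lparr>carrier := M\<rparr>) \<and>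
      ((\<exists>G. maximal_subgroup G (L_set \<iota>) \<and> \<not> is_singleton G) \<longrightarrow>
        mult_on (L_set \<iota>) 1 \<cong> integer_group)) \<and>
    \<comment> \<open>(xi)\<close>
     (open (up_ebic \<iota>) \<and> (I_set \<iota> \<noteq> {} \<longrightarrow> closed (I_set \<iota>))) \<and>
    \<comment> \<open>(xii)\<close>
     (\<not> is_singleton (group_of_units :: 'a set) \<longrightarrow>
        (group_of_units :: 'a set) = UNIV - (range \<iota> \<union> I_set \<iota>))"
proof -
  interpret dense_ebic \<iota>
    by unfold_locales (rule embedding, rule dense)
  have L: "L_set \<iota> \<noteq> {} \<longrightarrow>
      subsemigroup (L_set \<iota>) \<and>
      (\<forall>a \<in> L_set \<iota>. \<exists>U. open U \<and> a \<in> U \<and> constant_difference_on \<iota> U)"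
    using L_set_subsemigroup L_set_neighbourhood by metis
  have bounded: "L_set \<iota> \<noteq> {} \<longrightarrow>
      (\<forall>a \<in> L_set \<iota>. \<exists>U n\<^sub>a. open U \<and> a \<in> U \<and> coords_bounded_on \<iota> U n\<^sub>a)"
    using L_set_neighbourhood by metis
  have up: "subsemigroup (up_ebic \<iota>)"
    using up_ebic_mult by (auto simp: subsemigroup_def up_ebic_def)
  have local: "\<forall>a. a \<notin> range \<iota> \<and>
        (\<exists>U. open U \<and> a \<in> U \<and> constant_difference_on \<iota> U \<and>
          (\<exists>n\<^sub>a. coords_bounded_on \<iota> U n\<^sub>a)) \<longrightarrow>
        a \<in> L_set \<iota>"
    using L_setI by blast
  have U: "\<forall>a b.
        {x. x * \<iota> (b, b) = \<iota> (a, b)} = {x. \<iota> (a, a) * x = \<iota> (a, b)} \<and>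
        {x. \<iota> (a, a) * x = \<iota> (a, b)} = {x. \<iota> (a, a) * x * \<iota> (b, b) = \<iota> (a, b)} \<and>
        closed (up_elem \<iota> a b) \<and> open (up_elem \<iota> a b)" (is "\<forall>a b. ?P a b")
  proof (intro allI)
    fix a b
    have "{x. x * \<iota> (b, b) = \<iota> (a, b)} = U a b" "{x. \<iota> (a, a) * x = \<iota> (a, b)} = U a b"
      "{x. \<iota> (a, a) * x * \<iota> (b, b) = \<iota> (a, b)} = U a b"
      using in_U_iff_right in_U_iff_left by (blast, blast, simp add: U_def)
    then show "?P a b"
      using closed_U open_U by (simp add: up_elem_eq_U)
  qed
  have singleton: "\<forall>a b. is_singleton (up_elem \<iota> a b \<inter> L_set \<iota>) \<or> up_elem \<iota> a b \<inter> L_set \<iota> = {}"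
    using up_elem_Int_L_set by blast
  \<comment> \<open>This complement is \<open>L\<close>, which reduces the claim on units to
    \<open>group_of_units_eq_L_set\<close>.\<close>
  have I: "UNIV - (range \<iota> \<union> I_set \<iota>) = L_set \<iota>"
    by (auto simp: I_set_def up_ebic_def L_set_def)
  show ?thesis
  proof (intro conjI)
    show "\<exists>M. submonoid M integer_group \<and>
        mult_on (L_set \<iota>) 1 \<cong> integer_group\<lparr>carrier := M\<rparr>"
      using shifts_submonoid L_set_iso_shifts by blast
    show "(\<exists>G. maximal_subgroup G (L_set \<iota>) \<and> \<not> is_singleton G) \<longrightarrow>
        mult_on (L_set \<iota>) 1 \<cong> integer_group"
      using L_set_iso_integer_group by (auto simp: maximal_subgroup_def)
    show "I_set \<iota> \<noteq> {} \<longrightarrow> closed (I_set \<iota>)"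
      using open_up_ebic by (simp add: I_set_def closed_Compl)
    show "\<not> is_singleton (group_of_units :: 'a set) \<longrightarrow>
        (group_of_units :: 'a set) = UNIV - (range \<iota> \<union> I_set \<iota>)"
      unfolding I using group_of_units_eq_L_set by blast
    show "I_set \<iota> \<noteq> {} \<longrightarrow> semigroup_ideal (I_set \<iota>) UNIV"
      using I_set_ideal by blast
  qed (fact L L[unfolded L_set_eq_R_set] bounded bounded[unfolded L_set_eq_R_set] L_set_eq_R_set up
      minimal_ideal_range local U singleton open_up_ebic)+
qed

end
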